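(* Let $d\ge 1$ and let $X$ be a finite pure $d$-dimensional simplicial complex which is an $\alpha$-skeleton expander. If $\alpha < (\sqrt[2^d]{2}-1)/\sqrt{2}$, then $X$ is an $\epsilon$-colorful expander for $$\epsilon = \left(\frac{\sqrt[2^d]{2}-1-\sqrt2\alpha}{2\sqrt2\,d}\right)^d.$$
   Context: A simplicial complex $X$ on a finite vertex set is a family of subsets (faces) closed under taking subsets; it contains the empty face $\emptyset$. A face $\sigma$ has dimension $|\sigma|-1$; $X(i)$ is the set of $i$-dimensional faces ($X(-1)=\{\emptyset\}$). $X$ is $d$-dimensional if its maximal face dimension is $d$, and pure if every face is contained in a $d$-face. The degree $\deg(\sigma)$ of a face is the number of $d$-faces containing it. An $i$-cochain is a subset $W\subseteq X(i)$; $C^i(X)$ denotes the set of $i$-cochains. The norm of $W\in C^i(X)$ is $\|W\|=\sum_{\sigma\in W}\deg(\sigma)/\sum_{\tau\in X(i)}\deg(\tau)$. The link of a face $\sigma$ is $X_\sigma=\{\tau\setminus\sigma:\tau\in X,\ \tau\supseteq\sigma\}$, a pure complex of dimension $d-|\sigma|$; $\|\cdot\|_\sigma$ denotes the norm computed inside $X_\sigma$ (degrees counted as numbers of top-dimensional faces of $X_\sigma$). $X$ is an $\alpha$-skeleton expander ($\alpha>0$) if for every face $\sigma\in X$ (including $\sigma=\emptyset$, for which $X_\emptyset=X$) and every $S\subseteq X_\sigma(0)$, $\|E(S)\|_\sigma\le\|S\|_\sigma(\|S\|_\sigma+\alpha)$, where $E(S)\subseteq X_\sigma(1)$ is the set of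 edges of $X_\sigma$ with both endpoints in $S$. For $W\in C^i(X)$, $0\le i<d$, the expanding faces are $\psi(W)=\{\tau\in X(i+1):\exists\,\sigma,\sigma'\subset\tau \text{ with } \sigma\in W,\ \sigma'\in X(i)\setminus W\}$. $X$ is an $\epsilon$-colorful expander ($\epsilon>0$) if for every $0\le i<d$ and every $W\in C^i(X)$ with $0<\|W\|\le 1/2$, one has $\|\psi(W)\|/\|W\|\ge\epsilon$. *)

theory Defs
  imports Complex_Main
begin

definition simplicial_complex :: "'a set set \<Rightarrow> bool" where
  "simplicial_complex X \<longleftrightarrow>
     finite (\<Union>X) \<and> {} \<in> X \<and> (\<forall>\<sigma>\<in>X. \<forall>\<tau>. \<tau> \<subseteq> \<sigma> \<longrightarrow> \<tau> \<in> X)"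

text \<open>Dimensions are integers, so that the empty face has dimension \<open>-1\<close>.\<close>

definition face_dim :: "'a set \<Rightarrow> int" where
  "face_dim \<sigma> = int (card \<sigma>) - 1"

definition faces :: "'a set set \<Rightarrow> int \<Rightarrow> 'a set set" where
  "faces X i = {\<sigma> \<in> X. face_dim \<sigma> = i}"

definition complex_dim :: "'a set set \<Rightarrow> int" where
  "complex_dim X = Max (face_dim ` X)"

definition pure :: "'a set set \<Rightarrow> bool" where
  "pure X \<longleftrightarrow> (\<forall>\<sigma>\<in>X. \<exists>\<tau>\<in>faces X (complex_dim X). \<sigma> \<subseteq> \<tau>)"

definition deg :: "'a set set \<Rightarrow> 'a set \<Rightarrow> nat" where
  "deg X \<sigma> = card {\<tau> \<in> faces X (complex_dim X). \<sigma> \<subseteq> \<tau>}"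

definition cochains :: "'a set set \<Rightarrow> int \<Rightarrow> 'a set set set" where
  "cochains X i = Pow (faces X i)"

text \<open>The norm of an \<open>i\<close>-cochain \<open>W\<close>. When \<open>faces X i\<close> is empty the quotient is \<open>0 / 0 = 0\<close>;
  this arises only for links of dimension less than one.\<close>

definition cochain_norm :: "'a set set \<Rightarrow> int \<Rightarrow> 'a set set \<Rightarrow> real" where
  "cochain_norm X i W =
     (\<Sum>\<sigma>\<in>W. real (deg X \<sigma>)) / (\<Sum>\<tau>\<in>faces X i. real (deg X \<tau>))"

definition link :: "'a set set \<Rightarrow> 'a set \<Rightarrow> 'a set set" where
  "link X \<sigma> = {\<tau> - \<sigma> | \<tau>. \<tau> \<in> X \<and> \<sigma> \<subseteq> \<tau>}"

text \<open>The vertices in \<open>S\<close> are \<open>0\<close>-dimensional faces, that is, singletons.\<close>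

definition edges_within :: "'a set set \<Rightarrow> 'a set set \<Rightarrow> 'a set set" where
  "edges_within X S = {e \<in> faces X 1. \<forall>v\<in>e. {v} \<in> S}"

definition skeleton_expander :: "real \<Rightarrow> 'a set set \<Rightarrow> bool" where
  "skeleton_expander \<alpha> X \<longleftrightarrow> \<alpha> > 0 \<and>
     (\<forall>\<sigma>\<in>X. \<forall>S\<in>cochains (link X \<sigma>) 0.
        cochain_norm (link X \<sigma>) 1 (edges_within (link X \<sigma>) S)
          \<le> cochain_norm (link X \<sigma>) 0 S * (cochain_norm (link X \<sigma>) 0 S + \<alpha>))"

definition expanding_faces :: "'a set set \<Rightarrow> int \<Rightarrow> 'a set set \<Rightarrow> 'a set set" where
  "expanding_faces X i W =
     {\<tau> \<in> faces X (i + 1).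
        \<exists>\<sigma> \<sigma>'. \<sigma> \<subset> \<tau> \<and> \<sigma>' \<subset> \<tau> \<and> \<sigma> \<in> W \<and> \<sigma>' \<in> faces X i - W}"

definition colorful_expander :: "real \<Rightarrow> 'a set set \<Rightarrow> bool" where
  "colorful_expander \<epsilon> X \<longleftrightarrow> \<epsilon> > 0 \<and>
     (\<forall>i W. 0 \<le> i \<and> i < complex_dim X \<and> W \<in> cochains X i
        \<and> 0 < cochain_norm X i W \<and> cochain_norm X i W \<le> 1 / 2
        \<longrightarrow> cochain_norm X (i + 1) (expanding_faces X i W) / cochain_norm X i W \<ge> \<epsilon>)"

end

theory Submission
  imports Defs
begin

text \<open>
  Both \<open>W\<close> and its complement are treated symmetrically: the claim proved is
  \<open>\<parallel>\<psi>(W)\<parallel> \<ge> q\<^sup>k min(\<parallel>W\<parallel>, 1 - \<parallel>W\<parallel>)\<close> for \<open>W\<close> consisting of faces with \<open>k\<close> vertices, by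
  induction on \<open>k\<close>. Given \<open>W\<close> on faces with \<open>k + 1\<close> vertices, skeleton expansion in the link
  of a \<open>k\<close>-vertex face \<open>\<sigma>\<close> bounds the weight of the minority among the faces above \<open>\<sigma>\<close>
  (in \<open>W\<close> or not in \<open>W\<close>) by the weight of \<open>\<psi>(W)\<close> above \<open>\<sigma>\<close>. Let \<open>S\<close> be the set of those \<open>\<sigma>\<close>
  for which \<open>W\<close> is the majority. The total minority weight \<open>M\<close> then controls both the
  difference between the norms of \<open>S\<close> and \<open>W\<close> and the norm of \<open>\<psi>(S)\<close>, because a face of \<open>\<psi>(S)\<close>
  disagrees with at least one of its subfaces. So if \<open>\<psi>(W)\<close> were small, then \<open>\<psi>(S)\<close> would be
  small too, contradicting the induction hypothesis. The resulting rate
  \<open>q = (1 - 2\<alpha>) / (d + 1)\<close> exceeds the one required.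
\<close>

text \<open>Faces are indexed by their number of vertices, so \<open>level X k\<close> is \<open>X(k - 1)\<close>.\<close>

definition level :: "'a set set \<Rightarrow> nat \<Rightarrow> 'a set set" where
  "level X k = {\<sigma> \<in> X. card \<sigma> = k}"

text \<open>The norm without its denominator. Double counting stays additive in this form, and
  division is postponed to the places where norms are compared.\<close>

definition weight :: "'a set set \<Rightarrow> 'a set set \<Rightarrow> real" where
  "weight X A = (\<Sum>\<sigma>\<in>A. real (deg X \<sigma>))"

section \<open>Elementary facts on faces and subsets\<close>

lemma faces_eq_level: "faces X (int k - 1) = level X k"
  by (auto simp: faces_def level_def face_dim_def)

lemma faces_0_eq_level: "faces X 0 = level X 1"
  using faces_eq_level[of X 1] by simp

lemma faces_1_eq_level: "faces X 1 = level X 2"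
  using faces_eq_level[of X 2] by simp

text \<open>These sets are exactly \<open>insert v \<sigma>\<close> for \<open>v\<close> in
  \<open>T - \<sigma>\<close>, without repetition.\<close>

lemma card_one_larger_between:
  assumes "finite T" "\<sigma> \<subseteq> T"
  shows "card {\<tau>. \<sigma> \<subseteq> \<tau> \<and> \<tau> \<subseteq> T \<and> card \<tau> = card \<sigma> + 1} = card T - card \<sigma>"
proof -
  have fin: "finite \<sigma>" using assms finite_subset by blast
  have "{\<tau>. \<sigma> \<subseteq> \<tau> \<and> \<tau> \<subseteq> T \<and> card \<tau> = card \<sigma> + 1} = (\<lambda>v. insert v \<sigma>) ` (T - \<sigma>)"
  proof (intro set_eqI iffI)
    fix \<tau> assume "\<tau> \<in> {\<tau>. \<sigma> \<subseteq> \<tau> \<and> \<tau> \<subseteq> T \<and> card \<tau> = card \<sigma> + 1}"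
    then have \<tau>: "\<sigma> \<subseteq> \<tau>" "\<tau> \<subseteq> T" "card \<tau> = card \<sigma> + 1" by auto
    then have "card (\<tau> - \<sigma>) = 1" using fin by (simp add: card_Diff_subset)
    then obtain v where "\<tau> - \<sigma> = {v}" by (auto simp: card_1_singleton_iff)
    then show "\<tau> \<in> (\<lambda>v. insert v \<sigma>) ` (T - \<sigma>)" using \<tau> by (intro image_eqI[of _ _ v]) auto
  qed (use assms fin in auto)
  moreover have "inj_on (\<lambda>v. insert v \<sigma>) (T - \<sigma>)" by (auto simp: inj_on_def)
  ultimately show ?thesis
    using assms fin by (simp add: card_image card_Diff_subset)
qed

lemma inj_on_Diff_supersets: "inj_on (\<lambda>\<tau>. \<tau> - \<sigma>) {\<tau>. \<sigma> \<subseteq> \<tau>}"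
  by (auto simp: inj_on_def)

text \<open>Expansion asks for one subface inside and one outside the cochain, which is symmetric.
  This justifies bounds by the minimum of a cochain and its complement.\<close>

lemma expanding_compl:
  "W \<subseteq> faces X i \<Longrightarrow> expanding_faces X i (faces X i - W) = expanding_faces X i W"
  by (auto simp: expanding_faces_def)

section \<open>Double counting of degrees in a pure complex\<close>

locale pure_complex =
  fixes X :: "'a set set" and n :: nat
  assumes simplicial: "simplicial_complex X"
    and pure: "pure X"
    and dim: "complex_dim X = int n - 1" \<comment> \<open>\<open>n\<close> is the number of vertices of a top face, not the dimension\<close>
begin

lemma finite_complex: "finite X"
proof (rule finite_subset)
  show "X \<subseteq> Pow (\<Union>X)" by auto
qed (use simplicial in \<open>simp add: simplicial_complex_def\<close>)

lemma finite_face: "\<sigma> \<in> X \<Longrightarrow> finite \<sigma>"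
  using simplicial by (auto simp: simplicial_complex_def intro: finite_subset)

lemma subface: "\<sigma> \<in> X \<Longrightarrow> \<tau> \<subseteq> \<sigma> \<Longrightarrow> \<tau> \<in> X"
  using simplicial by (auto simp: simplicial_complex_def)

lemma finite_level [simp]: "finite (level X k)"
  using finite_complex by (simp add: level_def)

lemma top_faces: "faces X (complex_dim X) = level X n"
  by (simp add: dim faces_eq_level)

lemma deg_eq: "deg X \<sigma> = card {T \<in> level X n. \<sigma> \<subseteq> T}"
  by (simp add: deg_def top_faces)

lemma extend_to_top:
  assumes "\<sigma> \<in> X" obtains T where "T \<in> level X n" "\<sigma> \<subseteq> T"
  using pure assms by (auto simp: pure_def top_faces)

lemma card_face_le: "\<sigma> \<in> X \<Longrightarrow> card \<sigma> \<le> n"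
  by (erule extend_to_top) (auto simp: level_def intro: card_mono finite_face)

lemma deg_pos: "\<sigma> \<in> X \<Longrightarrow> deg X \<sigma> > 0"
  by (auto simp: deg_eq card_gt_0_iff elim: extend_to_top)

text \<open>A top face \<open>T\<close> above \<sigma> is counted once for each \<tau> between
  \<sigma> and \<open>T\<close>, and each such \<tau> adds to \<sigma> one of the
  \<open>n - k\<close> vertices of \<open>T - \<sigma>\<close>.\<close>

lemma sum_deg_above:
  assumes "\<sigma> \<in> level X k"
  shows "weight X {\<tau> \<in> level X (k + 1). \<sigma> \<subseteq> \<tau>} = (real n - real k) * real (deg X \<sigma>)"
proof -
  let ?B = "{\<tau> \<in> level X (k + 1). \<sigma> \<subseteq> \<tau>}" and ?T = "{T \<in> level X n. \<sigma> \<subseteq> T}"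
  have \<sigma>: "\<sigma> \<in> X" "card \<sigma> = k" using assms by (auto simp: level_def)
  have "weight X ?B = real (\<Sum>\<tau>\<in>?B. card {T \<in> ?T. \<tau> \<subseteq> T})"
    unfolding weight_def of_nat_sum deg_eq
    by (intro sum.cong refl arg_cong[of _ _ "\<lambda>x. real (card x)"]) auto
  also have "(\<Sum>\<tau>\<in>?B. card {T \<in> ?T. \<tau> \<subseteq> T}) = (n - k) * card ?T"
  proof (rule sum_multicount)
    show "\<forall>T\<in>?T. card {\<tau> \<in> ?B. \<tau> \<subseteq> T} = n - k"
    proof
      fix T assume T: "T \<in> ?T"
      then have "{\<tau> \<in> ?B. \<tau> \<subseteq> T} = {\<tau>. \<sigma> \<subseteq> \<tau> \<and> \<tau> \<subseteq> T \<and> card \<tau> = card \<sigma> + 1}"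
        using subface \<sigma> by (auto simp: level_def)
      then show "card {\<tau> \<in> ?B. \<tau> \<subseteq> T} = n - k"
        using T \<sigma> card_one_larger_between[of T \<sigma>] finite_face by (auto simp: level_def)
    qed
  qed simp_all
  finally show ?thesis using card_face_le[OF \<sigma>(1)] \<sigma>(2) by (simp add: deg_eq)
qed

lemma card_subfaces:
  assumes "\<tau> \<in> X"
  shows "card {\<sigma> \<in> level X k. \<sigma> \<subseteq> \<tau>} = card \<tau> choose k"
proof -
  have "{\<sigma> \<in> level X k. \<sigma> \<subseteq> \<tau>} = {\<sigma>. \<sigma> \<subseteq> \<tau> \<and> card \<sigma> = k}"
    using assms subface by (auto simp: level_def)
  then show ?thesis using n_subsets[OF finite_face[OF assms]] by simp
qed

text \<open>Exchange of summation: each \<tau> in \<open>B\<close> is counted once per subface with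
  \<open>k\<close> vertices.\<close>

lemma sum_weight_above:
  assumes "B \<subseteq> level X m"
  shows "(\<Sum>\<sigma>\<in>level X k. weight X {\<tau> \<in> B. \<sigma> \<subseteq> \<tau>}) = real (m choose k) * weight X B"
proof -
  have B: "finite B" using assms finite_subset by fastforce
  have "(\<Sum>\<sigma>\<in>level X k. weight X {\<tau> \<in> B. \<sigma> \<subseteq> \<tau>})
      = (\<Sum>\<tau>\<in>B. \<Sum>\<sigma> | \<sigma> \<in> level X k \<and> \<sigma> \<subseteq> \<tau>. real (deg X \<tau>))"
    unfolding weight_def using B by (intro sum.swap_restrict) auto
  also have "\<dots> = (\<Sum>\<tau>\<in>B. real (m choose k) * real (deg X \<tau>))"
    using assms card_subfaces by (intro sum.cong) (auto simp: level_def)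
  finally show ?thesis by (simp add: weight_def sum_distrib_left)
qed

lemma weight_nonneg: "weight X A \<ge> 0"
  by (simp add: weight_def sum_nonneg)

lemma weight_mono: "B \<subseteq> level X k \<Longrightarrow> A \<subseteq> B \<Longrightarrow> weight X A \<le> weight X B"
  unfolding weight_def by (rule sum_mono2) (auto intro: finite_subset)

lemma weight_compl:
  "A \<subseteq> level X k \<Longrightarrow> weight X A + weight X (level X k - A) = weight X (level X k)"
  unfolding weight_def by (subst add.commute, rule sum.subset_diff[symmetric]) auto

lemma sum_weight_above_subset:
  assumes "S \<subseteq> level X k"
  shows "(\<Sum>\<sigma>\<in>S. weight X {\<tau> \<in> level X (k + 1). \<sigma> \<subseteq> \<tau>}) = (real n - real k) * weight X S"
  unfolding weight_def[of X S] sum_distrib_left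
  using assms by (intro sum.cong refl sum_deg_above) auto

text \<open>Both sides count incidences between the two levels, from above and from below. This
  ratio converts inequalities between weights into inequalities between norms.\<close>

lemma weight_level_Suc:
  "(real k + 1) * weight X (level X (k + 1)) = (real n - real k) * weight X (level X k)"
  using sum_weight_above[of "level X (k + 1)" "k + 1" k] sum_weight_above_subset[of "level X k" k]
  by (simp add: add.commute)

lemma level_nonempty: "k \<le> n \<Longrightarrow> level X k \<noteq> {}"
proof -
  assume k: "k \<le> n"
  obtain T where T: "T \<in> X" "card T = n"
    using simplicial extend_to_top[of "{}"] by (auto simp: simplicial_complex_def level_def)
  then obtain \<sigma> where "\<sigma> \<subseteq> T" "card \<sigma> = k" using k obtain_subset_with_card_n by metis
  then show ?thesis using T subface by (auto simp: level_def)
qed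

lemma weight_level_pos: "k \<le> n \<Longrightarrow> weight X (level X k) > 0"
  unfolding weight_def using level_nonempty[of k] deg_pos
  by (intro sum_pos) (auto simp: level_def finite_complex)

section \<open>Skeleton expansion turned into expansion of vertex sets\<close>

text \<open>The left side counts each edge once per endpoint in \<open>A\<close>. Two endpoints
  occur only for edges within \<open>A\<close>; an edge with exactly one is expanding.\<close>

lemma weight_vertices_le:
  assumes A: "A \<subseteq> level X 1"
  shows "(real n - 1) * weight X A
    \<le> 2 * weight X (edges_within X A) + weight X (expanding_faces X 0 A)"
proof -
  let ?E = "edges_within X A" and ?P = "expanding_faces X 0 A"
  have sub: "?E \<subseteq> level X 2" "?P \<subseteq> level X 2"
    by (auto simp: edges_within_def expanding_faces_def faces_1_eq_level)
  have finA: "finite A" using A finite_subset by fastforce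
  have "(real n - 1) * weight X A = (\<Sum>v\<in>A. \<Sum>e | e \<in> level X 2 \<and> v \<subseteq> e. real (deg X e))"
    using sum_weight_above_subset[OF A] by (simp add: weight_def numeral_2_eq_2)
  also have "\<dots> = (\<Sum>e\<in>level X 2. \<Sum>v | v \<in> A \<and> v \<subseteq> e. real (deg X e))"
    using finA by (intro sum.swap_restrict) auto
  also have "\<dots> \<le> (\<Sum>e\<in>level X 2. 2 * (if e \<in> ?E then real (deg X e) else 0)
                                  + (if e \<in> ?P then real (deg X e) else 0))"
  proof (rule sum_mono)
    fix e assume e: "e \<in> level X 2"
    let ?V = "{v. v \<in> A \<and> v \<subseteq> e}"
    have fe: "finite e" "card e = 2" "e \<in> X" using e finite_face by (auto simp: level_def)
    have V: "?V \<subseteq> (\<lambda>x. {x}) ` e" using A by (auto simp: level_def card_1_singleton_iff)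
    have le2: "card ?V \<le> 2"
      using card_mono[OF _ V] fe card_image_le[OF fe(1), of "\<lambda>x. {x}"] by simp
    have "real (card ?V) \<le> 2 * of_bool (e \<in> ?E) + of_bool (e \<in> ?P)"
    proof (cases "e \<in> ?E")
      case True
      then show ?thesis using le2 by simp
    next
      case False
      then obtain x where x: "x \<in> e" "{x} \<notin> A"
        using e by (auto simp: edges_within_def faces_1_eq_level)
      then have V': "?V \<subseteq> (\<lambda>x. {x}) ` (e - {x})" using V by auto
      have le1: "card ?V \<le> 1"
        using card_mono[OF _ V'] fe x card_image_le[of "e - {x}" "\<lambda>x. {x}"] by simp
      show ?thesis
      proof (cases "?V = {}")
        case True
        have "card ?V = 0" by (simp only: True card.empty)
        then show ?thesis by simp
      next
        case False
        then obtain v where v: "v \<in> A" "v \<subseteq> e" by auto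
        have "{x} \<in> level X 1" using x fe subface by (auto simp: level_def)
        moreover have "card v = 1" using v A by (auto simp: level_def)
        \<comment> \<open>\<open>expanding_faces\<close> demands proper inclusions; here they follow
          from cardinality 1 against 2.\<close>
        then have "v \<noteq> e" "{x} \<noteq> e" using fe by auto
        then have "v \<subset> e" "{x} \<subset> e" using x v by auto
        ultimately have "e \<in> ?P" using x v e
          by (simp add: expanding_faces_def faces_1_eq_level faces_0_eq_level) blast
        then show ?thesis using le1 by simp
      qed
    qed
    then have "real (card ?V) * real (deg X e)
        \<le> (2 * of_bool (e \<in> ?E) + of_bool (e \<in> ?P)) * real (deg X e)"
      by (rule mult_right_mono) simp
    then show "(\<Sum>v\<in>?V. real (deg X e)) \<le> 2 * (if e \<in> ?E then real (deg X e) else 0)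
                                  + (if e \<in> ?P then real (deg X e) else 0)"
      by (auto split: if_splits)
  qed
  also have "\<dots> = 2 * weight X ?E + weight X ?P"
    using sub by (simp add: weight_def sum.distrib sum_distrib_left[symmetric]
        sum.inter_restrict[symmetric] Int_absorb1)
  finally show ?thesis .
qed

text \<open>The assumption \<open>half\<close> gives \<open>A\<close> norm at most 1/2, so edges
  within \<open>A\<close> use up at most the share 1/2 + \<alpha> of the endpoint count. The
  remaining share must come from expanding edges.\<close>

lemma vertex_expansion_small:
  assumes n: "n \<ge> 2" and A: "A \<subseteq> level X 1"
    and sk: "cochain_norm X 1 (edges_within X A) \<le> cochain_norm X 0 A * (cochain_norm X 0 A + \<alpha>)"
    and half: "weight X A \<le> weight X (level X 1 - A)"
  shows "weight X (expanding_faces X 0 A) \<ge> (real n - 1) * (1/2 - \<alpha>) * weight X A"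
proof -
  let ?N = "weight X (level X 1)" and ?M = "weight X (level X 2)"
  define p where "p = weight X A / ?N"
  have pos: "?N > 0" "?M > 0" using weight_level_pos n by auto
  \<comment> \<open>The exact ratio of the two normalising weights, needed to clear the denominators
    of \<open>sk\<close>.\<close>
  have M: "2 * ?M = (real n - 1) * ?N" using weight_level_Suc[of 1] by (simp add: numeral_2_eq_2)
  have p: "p \<ge> 0" "p \<le> 1/2" "weight X A = p * ?N"
    using weight_compl[OF A] half pos weight_nonneg[of A] by (auto simp: p_def field_simps)
  have "weight X (edges_within X A) / ?M \<le> p * (p + \<alpha>)"
    using sk by (simp add: cochain_norm_def faces_0_eq_level faces_1_eq_level p_def weight_def)
  also have "\<dots> \<le> p * (1/2 + \<alpha>)" using p by (intro mult_left_mono) auto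
  finally have "2 * weight X (edges_within X A) \<le> p * (1/2 + \<alpha>) * (2 * ?M)"
    using pos by (simp add: field_simps)
  also have "\<dots> = (real n - 1) * (1/2 + \<alpha>) * weight X A" unfolding M p(3) by simp
  finally have "2 * weight X (edges_within X A) \<le> (real n - 1) * (1/2 + \<alpha>) * weight X A" .
  moreover have "(real n - 1) * weight X A
      = (real n - 1) * (1/2 + \<alpha>) * weight X A + (real n - 1) * (1/2 - \<alpha>) * weight X A"
    by (simp add: field_simps)
  ultimately show ?thesis using weight_vertices_le[OF A] by linarith
qed

lemma vertex_expansion:
  assumes n: "n \<ge> 2" and A: "A \<subseteq> level X 1"
    and sk: "\<And>S. S \<in> cochains X 0 \<Longrightarrow>
      cochain_norm X 1 (edges_within X S) \<le> cochain_norm X 0 S * (cochain_norm X 0 S + \<alpha>)"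
  shows "weight X (expanding_faces X 0 A)
    \<ge> (real n - 1) * (1/2 - \<alpha>) * min (weight X A) (weight X (level X 1 - A))"
proof (cases "weight X A \<le> weight X (level X 1 - A)")
  case True
  then show ?thesis
    using vertex_expansion_small[OF n A sk] A
    by (simp add: cochains_def faces_0_eq_level)
next
  case False
  have "level X 1 - (level X 1 - A) = A" using A by auto
  then show ?thesis
    using vertex_expansion_small[OF n _ sk, of "level X 1 - A"] A False expanding_compl[of A X 0]
    by (simp add: cochains_def faces_0_eq_level)
qed


section \<open>Links: faces, purity, degrees and weights\<close>

lemma link_iff: "\<sigma> \<in> X \<Longrightarrow> \<rho> \<in> link X \<sigma> \<longleftrightarrow> \<rho> \<inter> \<sigma> = {} \<and> \<rho> \<union> \<sigma> \<in> X"
proof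
  assume "\<rho> \<in> link X \<sigma>"
  then obtain \<tau> where \<tau>: "\<rho> = \<tau> - \<sigma>" "\<tau> \<in> X" "\<sigma> \<subseteq> \<tau>" by (auto simp: link_def)
  then have "\<rho> \<union> \<sigma> = \<tau>" by auto
  then show "\<rho> \<inter> \<sigma> = {} \<and> \<rho> \<union> \<sigma> \<in> X" using \<tau> by auto
next
  assume "\<rho> \<inter> \<sigma> = {} \<and> \<rho> \<union> \<sigma> \<in> X"
  then show "\<rho> \<in> link X \<sigma>"
    unfolding link_def by (intro CollectI exI[of _ "\<rho> \<union> \<sigma>"]) auto
qed

lemma level_link_iff:
  assumes "\<sigma> \<in> level X k"
  shows "\<rho> \<in> level (link X \<sigma>) j \<longleftrightarrow> \<rho> \<inter> \<sigma> = {} \<and> \<rho> \<union> \<sigma> \<in> level X (k + j)"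
proof -
  have \<sigma>: "\<sigma> \<in> X" "card \<sigma> = k" using assms by (auto simp: level_def)
  have "card (\<rho> \<union> \<sigma>) = card \<rho> + k" if "\<rho> \<inter> \<sigma> = {}" "\<rho> \<union> \<sigma> \<in> X"
    using that \<sigma> finite_face[of "\<rho> \<union> \<sigma>"] by (simp add: card_Un_disjoint)
  then show ?thesis using \<sigma> by (auto simp: level_def link_iff)
qed

text \<open>The image form suits reindexing of sums, since removing \<sigma> is injective on
  supersets of \<sigma>.\<close>

lemma level_link_eq:
  assumes "\<sigma> \<in> level X k"
  shows "level (link X \<sigma>) j = (\<lambda>\<tau>. \<tau> - \<sigma>) ` {\<tau> \<in> level X (k + j). \<sigma> \<subseteq> \<tau>}"
proof (intro set_eqI iffI)
  fix \<rho> assume "\<rho> \<in> level (link X \<sigma>) j"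
  then show "\<rho> \<in> (\<lambda>\<tau>. \<tau> - \<sigma>) ` {\<tau> \<in> level X (k + j). \<sigma> \<subseteq> \<tau>}"
    using level_link_iff[OF assms] by (intro image_eqI[of _ _ "\<rho> \<union> \<sigma>"]) auto
next
  fix \<rho> assume "\<rho> \<in> (\<lambda>\<tau>. \<tau> - \<sigma>) ` {\<tau> \<in> level X (k + j). \<sigma> \<subseteq> \<tau>}"
  then obtain \<tau> where \<tau>: "\<rho> = \<tau> - \<sigma>" "\<tau> \<in> level X (k + j)" "\<sigma> \<subseteq> \<tau>" by auto
  then have "\<rho> \<union> \<sigma> = \<tau>" by auto
  then show "\<rho> \<in> level (link X \<sigma>) j" using \<tau> by (auto simp: level_link_iff[OF assms])
qed

text \<open>For \<rho> in the link, a top face containing \<rho> \<union> \<sigma> loses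
  \<open>k\<close> vertices when \<sigma> is removed and still contains \<rho>. This yields both the
  dimension and the purity of the link.\<close>

lemma pure_complex_link:
  assumes "\<sigma> \<in> level X k"
  shows "pure_complex (link X \<sigma>) (n - k)"
proof
  have \<sigma>: "\<sigma> \<in> X" "card \<sigma> = k" using assms by (auto simp: level_def)
  have fin: "finite (link X \<sigma>)"
    using finite_complex by (auto simp: link_def)
  show simp: "simplicial_complex (link X \<sigma>)"
    unfolding simplicial_complex_def
  proof (intro conjI ballI allI impI)
    show "finite (\<Union> (link X \<sigma>))"
      using fin finite_face by (auto simp: link_def)
    show "{} \<in> link X \<sigma>" using \<sigma> by (simp add: link_iff)
    fix \<tau> \<rho> assume "\<tau> \<in> link X \<sigma>" "\<rho> \<subseteq> \<tau>"
    then show "\<rho> \<in> link X \<sigma>" using \<sigma>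
      by (auto simp: link_iff intro: subface[of "\<tau> \<union> \<sigma>"])
  qed
  have above: "\<exists>\<tau>\<in>level (link X \<sigma>) (n - k). \<rho> \<subseteq> \<tau>" if "\<rho> \<in> link X \<sigma>" for \<rho>
  proof -
    have \<rho>: "\<rho> \<inter> \<sigma> = {}" "\<rho> \<union> \<sigma> \<in> X" using that \<sigma> by (auto simp: link_iff)
    obtain T where T: "T \<in> level X n" "\<rho> \<union> \<sigma> \<subseteq> T" using extend_to_top[OF \<rho>(2)] .
    then have "T - \<sigma> \<in> level (link X \<sigma>) (n - k)" "\<rho> \<subseteq> T - \<sigma>"
      using card_face_le[OF \<sigma>(1)] \<sigma> \<rho> by (auto simp: level_link_eq[OF assms])
    then show ?thesis by auto
  qed
  have le: "card \<rho> \<le> n - k" if \<rho>: "\<rho> \<in> link X \<sigma>" for \<rho>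
  proof -
    obtain \<tau> where \<tau>: "\<tau> \<in> link X \<sigma>" "card \<tau> = n - k" "\<rho> \<subseteq> \<tau>"
      using above[OF \<rho>] by (auto simp: level_def)
    have "finite \<tau>" using \<tau>(1) finite_face by (auto simp: link_def)
    then show ?thesis using \<tau> card_mono by metis
  qed
  show dim: "complex_dim (link X \<sigma>) = int (n - k) - 1"
    unfolding complex_dim_def
  proof (rule Max_eqI)
    show "finite (face_dim ` link X \<sigma>)" using fin by simp
    show "y \<le> int (n - k) - 1" if "y \<in> face_dim ` link X \<sigma>" for y
      using that by (auto simp: face_dim_def dest!: le)
    \<comment> \<open>Extending the empty face shows that the upper bound is attained.\<close>
    have "{} \<in> link X \<sigma>" using \<sigma> by (simp add: link_iff)
    from above[OF this] show "int (n - k) - 1 \<in> face_dim ` link X \<sigma>"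
      by (force simp: level_def face_dim_def)
  qed
  show "Defs.pure (link X \<sigma>)"
    unfolding pure_def dim faces_eq_level using above by auto
qed

text \<open>Removing \<sigma> matches the top faces above \<tau> bijectively with those of the link
  above \<tau> - \<sigma>. Hence weights in links can be read off in \<open>X\<close>.\<close>

lemma deg_link:
  assumes "\<sigma> \<in> level X k" "\<sigma> \<subseteq> \<tau>"
  shows "deg (link X \<sigma>) (\<tau> - \<sigma>) = deg X \<tau>"
proof -
  interpret L: pure_complex "link X \<sigma>" "n - k" using assms by (intro pure_complex_link)
  have "k \<le> n" using assms card_face_le by (auto simp: level_def)
  then have "{T \<in> level (link X \<sigma>) (n - k). \<tau> - \<sigma> \<subseteq> T}
      = (\<lambda>\<tau>. \<tau> - \<sigma>) ` {T \<in> level X n. \<tau> \<subseteq> T}"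
    using assms(2) by (auto simp: level_link_eq[OF assms(1)])
  moreover have "inj_on (\<lambda>\<tau>. \<tau> - \<sigma>) {T \<in> level X n. \<tau> \<subseteq> T}"
    by (rule inj_on_subset[OF inj_on_Diff_supersets]) (use assms(2) in auto)
  ultimately show ?thesis by (simp add: L.deg_eq deg_eq card_image)
qed

lemma weight_link:
  assumes "\<sigma> \<in> level X k"
  shows "weight (link X \<sigma>) ((\<lambda>\<tau>. \<tau> - \<sigma>) ` {\<tau> \<in> B. \<sigma> \<subseteq> \<tau>}) = weight X {\<tau> \<in> B. \<sigma> \<subseteq> \<tau>}"
proof -
  have "inj_on (\<lambda>\<tau>. \<tau> - \<sigma>) {\<tau> \<in> B. \<sigma> \<subseteq> \<tau>}"
    by (rule inj_on_subset[OF inj_on_Diff_supersets]) auto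
  then show ?thesis
    unfolding weight_def by (subst sum.reindex) (auto simp: deg_link[OF assms] intro!: sum.cong)
qed

section \<open>Expansion around a single face\<close>

text \<open>Faces above \<sigma> with one more vertex are the vertices of its link, so vertex
  expansion applies there. The bound on \<open>k\<close> guarantees that the link has edges.\<close>

lemma local_expansion:
  assumes sk: "skeleton_expander \<alpha> X" and k: "k + 2 \<le> n" and \<sigma>: "\<sigma> \<in> level X k"
    and W: "W \<subseteq> level X (k + 1)"
  shows "(real n - real k - 1) * (1/2 - \<alpha>) *
      min (weight X {\<tau> \<in> W. \<sigma> \<subseteq> \<tau>}) (weight X {\<tau> \<in> level X (k + 1) - W. \<sigma> \<subseteq> \<tau>})
    \<le> weight X {\<tau> \<in> expanding_faces X (int k) W. \<sigma> \<subseteq> \<tau>}"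
proof -
  interpret L: pure_complex "link X \<sigma>" "n - k" using \<sigma> by (rule pure_complex_link)
  let ?f = "\<lambda>\<tau>. \<tau> - \<sigma>"
  let ?A = "?f ` {\<tau> \<in> W. \<sigma> \<subseteq> \<tau>}" and ?P = "?f ` {\<tau> \<in> expanding_faces X (int k) W. \<sigma> \<subseteq> \<tau>}"
  have \<sigma>X: "\<sigma> \<in> X" using \<sigma> by (simp add: level_def)
  have lev: "faces X (int k) = level X (k + 1)" "faces X (int k + 1) = level X (k + 2)"
    using faces_eq_level[of X "k + 1"] faces_eq_level[of X "k + 2"] by (simp_all add: add.commute)
  have A: "?A \<subseteq> level (link X \<sigma>) 1" using W by (auto simp: level_link_eq[OF \<sigma>])
  have compl: "level (link X \<sigma>) 1 - ?A = ?f ` {\<tau> \<in> level X (k + 1) - W. \<sigma> \<subseteq> \<tau>}"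
  proof -
    have "{\<tau> \<in> level X (k + 1) - W. \<sigma> \<subseteq> \<tau>} = {\<tau> \<in> level X (k + 1). \<sigma> \<subseteq> \<tau>} - {\<tau> \<in> W. \<sigma> \<subseteq> \<tau>}"
      by auto
    then show ?thesis
      unfolding level_link_eq[OF \<sigma>]
      using W by (simp add: inj_on_image_set_diff[OF inj_on_Diff_supersets[of \<sigma>]] Collect_mono_iff subset_iff)
  qed
  \<comment> \<open>Adding \<sigma> back to an edge and to its two endpoints gives a face of
    \<psi>(W) with its witnesses. The converse inclusion can fail: witnesses for a face of \<psi>(W)
    need not contain \<sigma>.\<close>
  have P: "expanding_faces (link X \<sigma>) 0 ?A \<subseteq> ?P"
  proof
    fix e assume "e \<in> expanding_faces (link X \<sigma>) 0 ?A"
    then obtain u v where e: "e \<in> level (link X \<sigma>) 2" and uv: "u \<subset> e" "v \<subset> e" "u \<in> ?A"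
        "v \<in> level (link X \<sigma>) 1 - ?A"
      by (auto simp: expanding_faces_def faces_1_eq_level faces_0_eq_level)
    obtain \<tau> where \<tau>: "e = \<tau> - \<sigma>" "\<tau> \<in> level X (k + 2)" "\<sigma> \<subseteq> \<tau>"
      using e by (auto simp: level_link_eq[OF \<sigma>])
    obtain u' where u': "u = u' - \<sigma>" "u' \<in> W" "\<sigma> \<subseteq> u'" using uv(3) by auto
    obtain v' where v': "v = v' - \<sigma>" "v' \<in> level X (k + 1) - W" "\<sigma> \<subseteq> v'"
      using uv(4) unfolding compl by auto
    have "u' \<subset> \<tau>" using uv(1) u' \<tau> by blast
    moreover have "v' \<subset> \<tau>" using uv(2) v' \<tau> by blast
    ultimately have "\<tau> \<in> expanding_faces X (int k) W"
      using u' v' \<tau> unfolding expanding_faces_def lev by blast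
    then show "e \<in> ?P" using \<tau> by auto
  qed
  have Psub: "?P \<subseteq> level (link X \<sigma>) 2"
    by (auto simp: level_link_eq[OF \<sigma>] expanding_faces_def lev)
  have "(real (n - k) - 1) * (1/2 - \<alpha>) *
      min (weight (link X \<sigma>) ?A) (weight (link X \<sigma>) (level (link X \<sigma>) 1 - ?A))
    \<le> weight (link X \<sigma>) (expanding_faces (link X \<sigma>) 0 ?A)"
    using sk \<sigma>X k A by (intro L.vertex_expansion) (auto simp: skeleton_expander_def)
  also have "\<dots> \<le> weight (link X \<sigma>) ?P" by (rule L.weight_mono[OF Psub P])
  finally show ?thesis
    using k unfolding compl weight_link[OF \<sigma>] by simp
qed

section \<open>Passage from one level to the next\<close>

lemma weight_UN_le:
  assumes "finite I" "\<And>i. i \<in> I \<Longrightarrow> finite (B i)"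
  shows "weight X (\<Union>i\<in>I. B i) \<le> (\<Sum>i\<in>I. weight X (B i))"
  using assms
proof (induction I rule: finite_induct)
  case (insert i I)
  have "weight X (B i \<union> \<Union>(B ` I)) + weight X (B i \<inter> \<Union>(B ` I)) = weight X (B i) + weight X (\<Union>(B ` I))"
    unfolding weight_def using insert by (intro sum.union_inter) auto
  then show ?case using insert weight_nonneg[of "B i \<inter> \<Union>(B ` I)"] by simp
qed (simp add: weight_def)

text \<open>Divided by the total weights via \<open>weight_level_Suc\<close>, \<open>IH\<close> says
  that the norm of \<psi>(S) is at least \<epsilon> times the smaller of the norms of
  \<open>S\<close> and its complement. The conclusion is the same one level up, with \<epsilon>
  multiplied by \<open>(1 - 2 * \<alpha>) / (real k + 2)\<close>.\<close>

lemma expansion_step: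
  assumes sk: "skeleton_expander \<alpha> X" and \<alpha>: "\<alpha> \<le> 1/2" and k: "k + 2 \<le> n"
    and \<epsilon>: "0 \<le> \<epsilon>" "\<epsilon> \<le> 1"
    and IH: "\<And>S. S \<subseteq> level X k \<Longrightarrow>
      \<epsilon> * (real n - real k) * min (weight X S) (weight X (level X k - S))
        \<le> (real k + 1) * weight X (expanding_faces X (int k - 1) S)"
    and W: "W \<subseteq> level X (k + 1)"
  shows "(1 - 2 * \<alpha>) / (real k + 2) * \<epsilon> * (real n - real k - 1)
        * min (weight X W) (weight X (level X (k + 1) - W))
    \<le> (real k + 2) * weight X (expanding_faces X (int k) W)"
proof -
  define a where "a \<sigma> = weight X {\<tau> \<in> W. \<sigma> \<subseteq> \<tau>}" for \<sigma>
  define b where "b \<sigma> = weight X {\<tau> \<in> level X (k + 1) - W. \<sigma> \<subseteq> \<tau>}" for \<sigma>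
  define S where "S = {\<sigma> \<in> level X k. b \<sigma> \<le> a \<sigma>}"
  define M where "M = (\<Sum>\<sigma>\<in>level X k. min (a \<sigma>) (b \<sigma>))"
  define m where "m = min (weight X W) (weight X (level X (k + 1) - W))"
  let ?P = "expanding_faces X (int k) W"
  have S: "S \<subseteq> level X k" by (auto simp: S_def)
  have nonneg: "a \<sigma> \<ge> 0" "b \<sigma> \<ge> 0" for \<sigma> by (auto simp: a_def b_def weight_nonneg)
  have Psub: "?P \<subseteq> level X (k + 2)"
    using faces_eq_level[of X "k + 2"] by (auto simp: expanding_faces_def add.commute)

  \<comment> \<open>Local expansion is summed over all \<sigma>; a face of \<psi>(W) has
    \<open>k + 2\<close> vertices and is counted once per subface with \<open>k\<close>
    vertices.\<close>
  have "(real n - real k - 1) * (1/2 - \<alpha>) * M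
      = (\<Sum>\<sigma>\<in>level X k. (real n - real k - 1) * (1/2 - \<alpha>) * min (a \<sigma>) (b \<sigma>))"
    by (simp add: M_def sum_distrib_left)
  also have "\<dots> \<le> (\<Sum>\<sigma>\<in>level X k. weight X {\<tau> \<in> ?P. \<sigma> \<subseteq> \<tau>})"
    unfolding a_def b_def by (intro sum_mono local_expansion[OF sk k _ W])
  also have "\<dots> = real (k + 2 choose k) * weight X ?P"
    by (rule sum_weight_above[OF Psub])
  also have "real (k + 2 choose k) = (real k + 1) * (real k + 2) / 2"
  proof -
    have "k + 2 choose k = k + 2 choose 2" using binomial_symmetric[of k "k + 2"] by simp
    also have "2 * \<dots> = (k + 1) * (k + 2)"
      by (simp add: choose_two)
    finally have "real (2 * (k + 2 choose k)) = real ((k + 1) * (k + 2))" by simp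
    then show ?thesis by (simp add: algebra_simps)
  qed
  finally have local: "(real n - real k - 1) * (1 - 2 * \<alpha>) * M
      \<le> (real k + 1) * (real k + 2) * weight X ?P"
    by (simp add: field_simps)

  have ab: "weight X {\<tau> \<in> level X (k + 1). \<sigma> \<subseteq> \<tau>} = a \<sigma> + b \<sigma>" for \<sigma>
  proof -
    have eq: "{\<tau> \<in> level X (k + 1). \<sigma> \<subseteq> \<tau>}
        = {\<tau> \<in> W. \<sigma> \<subseteq> \<tau>} \<union> {\<tau> \<in> level X (k + 1) - W. \<sigma> \<subseteq> \<tau>}"
      using W by auto
    show ?thesis
      unfolding a_def b_def weight_def eq
      by (rule sum.union_disjoint) (use finite_subset[OF W] in auto)
  qed
  have sumS: "(\<Sum>\<sigma>\<in>T. a \<sigma> + b \<sigma>) = (real n - real k) * weight X T" if "T \<subseteq> level X k" for T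
    using sum_weight_above_subset[OF that] by (simp only: ab)
  \<comment> \<open>Used for \<open>f = a\<close> with \<open>T = S\<close>, and for
    \<open>f = b\<close> with \<open>T\<close> the complement of \<open>S\<close>: the majority is
    bounded by everything above \<sigma>, the minority is charged to \<open>M\<close>.\<close>
  have split: "(\<Sum>\<sigma>\<in>level X k. f \<sigma>) \<le> (\<Sum>\<sigma>\<in>T. a \<sigma> + b \<sigma>) + M"
    if "T \<subseteq> level X k" "\<And>\<sigma>. \<sigma> \<in> T \<Longrightarrow> f \<sigma> \<le> a \<sigma> + b \<sigma>"
      "\<And>\<sigma>. \<sigma> \<in> level X k - T \<Longrightarrow> f \<sigma> \<le> min (a \<sigma>) (b \<sigma>)" for f T
  proof -
    have "(\<Sum>\<sigma>\<in>level X k. f \<sigma>)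
        \<le> (\<Sum>\<sigma>\<in>level X k. (if \<sigma> \<in> T then a \<sigma> + b \<sigma> else 0) + min (a \<sigma>) (b \<sigma>))"
    proof (rule sum_mono)
      fix \<sigma> assume "\<sigma> \<in> level X k"
      then show "f \<sigma> \<le> (if \<sigma> \<in> T then a \<sigma> + b \<sigma> else 0) + min (a \<sigma>) (b \<sigma>)"
        using that(2,3)[of \<sigma>] nonneg[of \<sigma>] by (cases "\<sigma> \<in> T") auto
    qed
    also have "\<dots> = (\<Sum>\<sigma>\<in>T. a \<sigma> + b \<sigma>) + M"
      using that(1) by (simp add: sum.distrib M_def sum.inter_restrict[symmetric] Int_absorb1)
    finally show ?thesis .
  qed
  have "(\<Sum>\<sigma>\<in>level X k. a \<sigma>) = (real k + 1) * weight X W"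
    using sum_weight_above[OF W, of k] by (simp add: a_def add.commute)
  moreover have "(\<Sum>\<sigma>\<in>level X k. a \<sigma>) \<le> (real n - real k) * weight X S + M"
    unfolding sumS[OF S, symmetric] by (rule split[OF S]) (auto simp: S_def nonneg)
  moreover have "(\<Sum>\<sigma>\<in>level X k. b \<sigma>) = (real k + 1) * weight X (level X (k + 1) - W)"
    using sum_weight_above[of "level X (k + 1) - W" "k + 1" k] by (simp add: b_def add.commute)
  moreover have "(\<Sum>\<sigma>\<in>level X k. b \<sigma>) \<le> (real n - real k) * weight X (level X k - S) + M"
    unfolding sumS[OF Diff_subset, symmetric]
    by (rule split[OF Diff_subset]) (auto simp: S_def nonneg)
  moreover have "(real k + 1) * m \<le> (real k + 1) * weight X W"
    "(real k + 1) * m \<le> (real k + 1) * weight X (level X (k + 1) - W)"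
    by (intro mult_left_mono; simp add: m_def)+
  ultimately have mass: "(real k + 1) * m
      \<le> (real n - real k) * min (weight X S) (weight X (level X k - S)) + M"
    unfolding min_def by (split if_split) linarith

  have PS: "weight X (expanding_faces X (int k - 1) S) \<le> M"
  proof -
    \<comment> \<open>\<open>B \<sigma>\<close> is the minority above \<sigma>. A face \<tau> of
      \<psi>(S) has subfaces \<sigma> in \<open>S\<close> and \<sigma>' outside \<open>S\<close>; it
      is in the minority above \<sigma>' if it belongs to \<open>W\<close>, and above \<sigma>
      otherwise.\<close>
    define B where "B \<sigma> = {\<tau> \<in> (if \<sigma> \<in> S then level X (k + 1) - W else W). \<sigma> \<subseteq> \<tau>}" for \<sigma>
    have Bsub: "B \<sigma> \<subseteq> level X (k + 1)" for \<sigma> using W by (auto simp: B_def)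
    have "expanding_faces X (int k - 1) S \<subseteq> (\<Union>\<sigma>\<in>level X k. B \<sigma>)"
    proof
      fix \<tau> assume "\<tau> \<in> expanding_faces X (int k - 1) S"
      then obtain \<sigma> \<sigma>' where "\<tau> \<in> level X (k + 1)" "\<sigma> \<subseteq> \<tau>" "\<sigma>' \<subseteq> \<tau>" "\<sigma> \<in> S" "\<sigma>' \<in> level X k - S"
        using faces_eq_level[of X "k + 1"] by (auto simp: expanding_faces_def faces_eq_level)
      then show "\<tau> \<in> (\<Union>\<sigma>\<in>level X k. B \<sigma>)"
        using S by (cases "\<tau> \<in> W") (auto simp: B_def intro: bexI[of _ \<sigma>] bexI[of _ \<sigma>'])
    qed
    then have "weight X (expanding_faces X (int k - 1) S) \<le> weight X (\<Union>\<sigma>\<in>level X k. B \<sigma>)"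
      using Bsub by (intro weight_mono[of _ "k + 1"]) auto
    also have "\<dots> \<le> (\<Sum>\<sigma>\<in>level X k. weight X (B \<sigma>))"
      using Bsub finite_subset by (intro weight_UN_le) fastforce+
    also have "\<dots> = M"
      unfolding M_def by (intro sum.cong) (auto simp: B_def S_def a_def b_def)
    finally show ?thesis .
  qed

  have "M \<ge> 0" unfolding M_def using nonneg by (intro sum_nonneg) simp
  \<comment> \<open>\<open>M\<close> is charged \<open>k + 1\<close> times through \<psi>(S) and, as
    \<epsilon> \<le> 1, at most once more for replacing \<open>W\<close> by \<open>S\<close>. This
    is the source of the factor \<open>k + 2\<close>.\<close>
  have "\<epsilon> * ((real k + 1) * m)
      \<le> \<epsilon> * ((real n - real k) * min (weight X S) (weight X (level X k - S)) + M)"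
    using mass \<epsilon> by (intro mult_left_mono)
  also have "\<dots> \<le> (real k + 1) * weight X (expanding_faces X (int k - 1) S) + \<epsilon> * M"
    using IH[OF S] by (simp add: algebra_simps)
  also have "\<dots> \<le> (real k + 1) * M + 1 * M"
    using PS \<epsilon> \<open>M \<ge> 0\<close> by (intro add_mono mult_left_mono mult_right_mono) auto
  finally have "\<epsilon> * (real k + 1) * m \<le> (real k + 2) * M" by (simp add: algebra_simps)
  then have "(real n - real k - 1) * (1 - 2 * \<alpha>) * (\<epsilon> * (real k + 1) * m)
      \<le> (real n - real k - 1) * (1 - 2 * \<alpha>) * ((real k + 2) * M)"
    using k \<alpha> by (intro mult_left_mono) auto
  also have "\<dots> \<le> (real k + 2) * ((real k + 1) * (real k + 2) * weight X ?P)"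
    using mult_left_mono[OF local, of "real k + 2"] by (simp add: algebra_simps)
  \<comment> \<open>The factor \<open>k + 1\<close> from the charge to \<open>M\<close> cancels the
    one in the binomial coefficient.\<close>
  finally have "(real k + 1) * ((real n - real k - 1) * (1 - 2 * \<alpha>) * \<epsilon> * m)
      \<le> (real k + 1) * ((real k + 2) * (real k + 2) * weight X ?P)"
    by (simp only: mult_ac)
  then have "(real n - real k - 1) * (1 - 2 * \<alpha>) * \<epsilon> * m
      \<le> (real k + 2) * (real k + 2) * weight X ?P"
    by (rule mult_left_le_imp_le) simp
  then show ?thesis unfolding m_def[symmetric] by (simp add: field_simps)
qed

section \<open>Induction over the levels\<close>

text \<open>The step costs a factor depending on \<open>k\<close>; the bound on
  \<open>q * real n\<close> makes \<open>q\<close> a lower bound for all of these factors, which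
  gives the power \<open>q ^ k\<close>.\<close>

lemma expansion_all_levels:
  assumes sk: "skeleton_expander \<alpha> X" and \<alpha>: "\<alpha> \<le> 1/2"
    and q: "0 \<le> q" "q \<le> 1" "q * real n \<le> 1 - 2 * \<alpha>"
  shows "k + 1 \<le> n \<Longrightarrow> W \<subseteq> level X k \<Longrightarrow>
    q ^ k * (real n - real k) * min (weight X W) (weight X (level X k - W))
      \<le> (real k + 1) * weight X (expanding_faces X (int k - 1) W)"
proof (induction k arbitrary: W)
  case 0
  \<comment> \<open>The only face without vertices is the empty one, so \<open>W\<close> or its
    complement is empty and the minimum vanishes.\<close>
  have "level X 0 = {{}}"
    using simplicial finite_face by (auto simp: level_def simplicial_complex_def)
  then have "W = {} \<or> level X 0 - W = {}" using 0 by auto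
  then have "weight X W = 0 \<or> weight X (level X 0 - W) = 0"
    by (elim disjE) (simp_all only: weight_def sum.empty simp_thms)
  then have "min (weight X W) (weight X (level X 0 - W)) = 0"
    using weight_nonneg[of W] weight_nonneg[of "level X 0 - W"] by (auto simp: min_def)
  then show ?case using weight_nonneg by simp
next
  case (Suc k)
  let ?m = "min (weight X W) (weight X (level X (k + 1) - W))"
  have "?m \<ge> 0" using weight_nonneg by simp
  have "q * (real k + 2) \<le> q * real n" using Suc.prems q by (intro mult_left_mono) auto
  then have "q \<le> (1 - 2 * \<alpha>) / (real k + 2)" using q by (simp add: field_simps)
  then have "q * (q ^ k * (real n - real k - 1) * ?m)
      \<le> (1 - 2 * \<alpha>) / (real k + 2) * (q ^ k * (real n - real k - 1) * ?m)"
    using q Suc.prems \<open>?m \<ge> 0\<close> by (intro mult_right_mono) auto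
  also have "\<dots> \<le> (real k + 2) * weight X (expanding_faces X (int k) W)"
    using expansion_step[OF sk \<alpha>, of k "q ^ k" W] Suc q by (simp add: power_le_one mult.assoc)
  finally show ?case by (simp add: algebra_simps)
qed

end

section \<open>Numerical estimates and return to norms\<close>

theorem theorem2p1:
  fixes X :: "'a set set" and d :: nat and \<alpha> :: real
  assumes "d \<ge> 1"
    and "simplicial_complex X"
    and "complex_dim X = int d"
    and "pure X"
    and "skeleton_expander \<alpha> X"
    and "\<alpha> < (root (2 ^ d) 2 - 1) / sqrt 2"
  shows "colorful_expander
           (((root (2 ^ d) 2 - 1 - sqrt 2 * \<alpha>) / (2 * sqrt 2 * real d)) ^ d) X"
proof -
  interpret pure_complex X "d + 1"
    using assms by unfold_locales auto
  define b where "b = (root (2 ^ d) 2 - 1 - sqrt 2 * \<alpha>) / (2 * sqrt 2 * real d)"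
  have \<alpha>0: "\<alpha> > 0" using assms by (simp add: skeleton_expander_def)
  have s: "1.4 \<le> sqrt 2" "sqrt 2 \<le> (1.5::real)"
    by (intro real_le_rsqrt real_le_lsqrt; simp add: power2_eq_square)+
  \<comment> \<open>Since \<open>d \<ge> 1\<close>, the root is at most the square root of 2, hence
    at most 1.5.\<close>
  have "(2::nat) ^ 1 \<le> 2 ^ d" using assms(1) by (intro power_increasing) auto
  then have "root (2 ^ d) 2 \<le> root 2 2" by (intro real_root_decreasing) auto
  then have r: "root (2 ^ d) 2 \<le> sqrt 2" by (simp add: sqrt_def)
  have \<alpha>s: "sqrt 2 * \<alpha> < root (2 ^ d) 2 - 1" using assms(6) by (simp add: field_simps)
  have "1.4 * \<alpha> \<le> sqrt 2 * \<alpha>" using s \<alpha>0 by (intro mult_right_mono) auto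
  then have \<alpha>: "\<alpha> < 1/2" using \<alpha>s r s by simp
  have b0: "b > 0" unfolding b_def using \<alpha>s assms(1) by simp
  have "b * (2 * real d) = (root (2 ^ d) 2 - 1) / sqrt 2 - \<alpha>"
    unfolding b_def using assms(1) by (simp add: field_simps)
  \<comment> \<open>The bound 0.5 / 1.4 is below 1/2. With \<open>d + 1 \<le> 2 * d\<close> this
    leaves enough room for \<open>b\<close> to serve as the rate \<open>q\<close>.\<close>
  also have "(root (2 ^ d) 2 - 1) / sqrt 2 \<le> 0.5 / 1.4"
    using r s by (intro frac_le) auto
  finally have b1: "b * (2 * real d) \<le> 1/2 - \<alpha>" by simp
  have "b * real (d + 1) \<le> b * (2 * real d)" using b0 assms(1) by (intro mult_left_mono) auto
  then have dd: "b * real (d + 1) \<le> 1 - 2 * \<alpha>" using b1 \<alpha> by simp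
  have "b * 1 \<le> b * (2 * real d)" using b0 assms(1) by (intro mult_left_mono) auto
  then have b2: "b \<le> 1" using b1 \<alpha>0 by simp
  show ?thesis
    unfolding colorful_expander_def b_def[symmetric]
  proof (intro conjI allI impI)
    show "b ^ d > 0" using b0 by simp
    fix i W
    assume *: "0 \<le> i \<and> i < complex_dim X \<and> W \<in> cochains X i
        \<and> 0 < cochain_norm X i W \<and> cochain_norm X i W \<le> 1 / 2"
    \<comment> \<open>The number of vertices of an \<open>i\<close>-dimensional face, which lies
      between 1 and \<open>d\<close>.\<close>
    define k where "k = nat i + 1"
    have k: "k \<le> d" and ik: "i = int k - 1" using * assms(3) by (auto simp: k_def)
    have fk: "faces X i = level X k" "faces X (i + 1) = level X (k + 1)"
      using faces_eq_level[of X k] faces_eq_level[of X "k + 1"] by (simp_all add: ik)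
    have W: "W \<subseteq> level X k" using * by (simp add: cochains_def fk)
    let ?N = "weight X (level X k)" and ?N' = "weight X (level X (k + 1))"
    have N: "?N > 0" "?N' > 0" using weight_level_pos k by auto
    have norm: "cochain_norm X i W = weight X W / ?N"
      "cochain_norm X (i + 1) B = weight X B / ?N'" for B
      by (simp_all add: cochain_norm_def fk weight_def)
    have w: "0 < weight X W" "weight X W \<le> weight X (level X k - W)"
      using * weight_compl[OF W] N by (auto simp: norm field_simps)
    let ?P = "weight X (expanding_faces X i W)"
    have "b ^ k * (real (d + 1) - real k) * weight X W \<le> (real k + 1) * ?P"
      using expansion_all_levels[OF assms(5), of b k W] \<alpha> b0 b2 dd k W w
      by (simp add: ik min_absorb1 del: of_nat_add)
    then have "b ^ k * (real (d + 1) - real k) * weight X W * ?N \<le> (real k + 1) * ?P * ?N"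
      using N by (intro mult_right_mono) auto
    \<comment> \<open>Exchanges the normalising weights of the two levels, turning the weight
      inequality into one between norms.\<close>
    moreover have "(real (d + 1) - real k) * ?N = (real k + 1) * ?N'"
      using weight_level_Suc[of k] by simp
    ultimately have "(real k + 1) * (b ^ k * weight X W * ?N') \<le> (real k + 1) * (?P * ?N)"
      by (metis (no_types, opaque_lifting) mult.assoc mult.commute)
    then have "b ^ k * weight X W * ?N' \<le> ?P * ?N"
      by (rule mult_left_le_imp_le) simp
    then have "b ^ k \<le> ?P / ?N' / (weight X W / ?N)"
      using N w by (simp add: field_simps)
    \<comment> \<open>As \<open>b \<le> 1\<close>, the top level \<open>k = d\<close> gives the
      smallest rate, hence the exponent \<open>d\<close>.\<close>
    moreover have "b ^ d \<le> b ^ k" using b0 b2 k by (intro power_decreasing) auto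
    ultimately show "b ^ d \<le> cochain_norm X (i + 1) (expanding_faces X i W) / cochain_norm X i W"
      by (simp add: norm)
  qed
qed

end
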